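(* Let $L\ge 1$, let $B=(b_1,\dots,b_L)$ be a base sequence of integers $b_i\ge 2$, let $P=\prod_{i=1}^L b_i$, $k=\lceil\log_2 P\rceil$, and suppose $r:=2^k \bmod P>0$. Let $V$ be uniformly distributed on $\{0,\dots,2^k-1\}$, and let $V' = V \bmod P$. Then: (i) each value $v\in\{0,\dots,r-1\}$ is taken by $V'$ with probability $2/2^k$, and each value $v\in\{r,\dots,P-1\}$ is taken by $V'$ with probability $1/2^k$; (ii) the digit tuple $(k_1,\dots,k_L)$ obtained by applying the inverse Horner decomposition to $V'$ is not uniformly distributed over $\mathcal{K}=\prod_{i=1}^L\{0,\dots,b_i-1\}$; (iii) the MR-OTP with base sequence $B$ and key $K=(k_1,\dots,k_L)$ distributed as in (ii) does not have perfect secrecy.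
   Context: Inverse Horner decomposition: given $B=(b_1,\dots,b_L)$ and $V\in\{0,\dots,P-1\}$, set $V^{(L)}=V$ and, for $i=L,L-1,\dots,1$, set $k_i=V^{(i)}\bmod b_i$ and $V^{(i-1)}=\lfloor V^{(i)}/b_i\rfloor$; the output is $(k_1,\dots,k_L)$. MR-OTP (Mixed-Radix One-Time Pad) with base sequence $B$: messages, keys and ciphertexts are tuples in $\prod_{i=1}^L\{0,\dots,b_i-1\}$; the message $m=(m_1,\dots,m_L)$ is encrypted under the key $(k_1,\dots,k_L)$ as $c=(c_1,\dots,c_L)$ with $c_i=(m_i+k_i)\bmod b_i$. The random message $M$ is independent of the random key $K$; $C$ denotes the random ciphertext. Perfect secrecy: for every message distribution $\Pr[M]$, every $c$ with $\Pr[C=c]>0$, and every $m$, $\Pr[M=m\mid C=c]=\Pr[M=m]$. *)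

theory Defs
  imports "HOL-Probability.Probability"
begin

text \<open>
  A base sequence \<open>(b\<^sub>1, \<dots>, b\<^sub>L)\<close> is a list \<open>B :: nat list\<close> and a digit tuple a list of the
  same length, so the mathematical index \<open>i\<close> corresponds to the list position \<open>i - 1\<close>.
\<close>

definition digit_tuples :: "nat list \<Rightarrow> nat list set" where
  "digit_tuples B = {x. length x = length B \<and> (\<forall>i<length B. x ! i \<in> {0..<B ! i})}"

text \<open>
  \<open>horner_quotient B V j\<close> is \<open>V\<^sup>(\<^sup>L\<^sup>-\<^sup>j\<^sup>)\<close>, the running quotient after the last \<open>j\<close> bases
  \<open>b\<^sub>L, b\<^sub>L\<^sub>-\<^sub>1, \<dots>\<close> have been divided out; it is meaningful for \<open>j \<le> length B\<close>.
\<close>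

fun horner_quotient :: "nat list \<Rightarrow> nat \<Rightarrow> nat \<Rightarrow> nat" where
  "horner_quotient B V 0 = V"
| "horner_quotient B V (Suc j) = horner_quotient B V j div B ! (length B - Suc j)"

definition inverse_horner :: "nat list \<Rightarrow> nat \<Rightarrow> nat list" where
  "inverse_horner B V =
     map (\<lambda>i. horner_quotient B V (length B - Suc i) mod B ! i) [0..<length B]"

definition mr_otp_encrypt :: "nat list \<Rightarrow> nat list \<Rightarrow> nat list \<Rightarrow> nat list" where
  "mr_otp_encrypt B key m = map (\<lambda>i. (m ! i + key ! i) mod B ! i) [0..<length B]"

text \<open>
  The joint law of \<open>(M, C)\<close>; the product \<open>pair_pmf M K\<close> expresses that the message is
  independent of the key.
\<close>

definition message_cipher_pmf ::
  "('k \<Rightarrow> 'm \<Rightarrow> 'c) \<Rightarrow> 'm pmf \<Rightarrow> 'k pmf \<Rightarrow> ('m \<times> 'c) pmf" where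
  "message_cipher_pmf enc M K = map_pmf (\<lambda>(m, key). (m, enc key m)) (pair_pmf M K)"

definition perfect_secrecy ::
  "'m set \<Rightarrow> ('k \<Rightarrow> 'm \<Rightarrow> 'c) \<Rightarrow> 'k pmf \<Rightarrow> bool" where
  "perfect_secrecy Msgs enc K \<longleftrightarrow>
     (\<forall>M. set_pmf M \<subseteq> Msgs \<longrightarrow>
        (\<forall>c. \<P>(x in message_cipher_pmf enc M K. snd x = c) > 0 \<longrightarrow>
           (\<forall>m\<in>Msgs. \<P>(x in message_cipher_pmf enc M K. fst x = m \<bar> snd x = c)
                      = \<P>(x in message_cipher_pmf enc M K. fst x = m))))"

end

theory Submission
  imports Defs
begin

text \<open>
  Since \<open>P < 2\<^sup>k < 2 P\<close>, reduction modulo \<open>P\<close> hits exactly the values below \<open>r = 2\<^sup>k - P\<close> twice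
  and the others once. The inverse Horner decomposition is injective on \<open>{0..<P}\<close>, so the digit
  tuples of \<open>0\<close> and \<open>P - 1\<close> have different probabilities. On the other hand, perfect secrecy
  tested against uniform messages makes the law of the ciphertext given a message independent of
  the message; in the MR-OTP every key is the unique one taking a suitable message to the fixed
  ciphertext \<open>(b\<^sub>1 - 1, \<dots>, b\<^sub>L - 1)\<close>, so all keys would be equally likely.
\<close>

lemma finite_digit_tuples: "finite (digit_tuples B)"
proof (rule finite_subset)
  show "digit_tuples B \<subseteq> {xs. set xs \<subseteq> (\<Union>i<length B. {0..<B ! i}) \<and> length xs = length B}"
    unfolding digit_tuples_def by (fastforce simp: in_set_conv_nth)
qed (intro finite_lists_length_eq, simp)

lemma inverse_horner_in_digit_tuples:
  assumes "\<forall>i<length B. B ! i > 0"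
  shows "inverse_horner B V \<in> digit_tuples B"
  using assms by (simp add: inverse_horner_def digit_tuples_def)

text \<open>Successive floor divisions compose into one division by the product. At
  \<open>j = length B\<close> the divisor is the full product, so the quotient vanishes for
  \<open>V\<close> below it.\<close>

lemma horner_quotient_eq_div:
  assumes "j \<le> length B"
  shows "horner_quotient B V j = V div (\<Prod>i\<in>{length B - j..<length B}. B ! i)"
  using assms
proof (induction j)
  case (Suc j)
  then have "{length B - Suc j..<length B} = insert (length B - Suc j) {length B - j..<length B}"
    by auto
  then have "(\<Prod>i\<in>{length B - Suc j..<length B}. B ! i)
      = (\<Prod>i\<in>{length B - j..<length B}. B ! i) * B ! (length B - Suc j)"
    using Suc.prems by (simp add: mult.commute)
  then show ?case
    using Suc by (simp add: div_mult2_eq)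
qed simp

lemma inj_on_inverse_horner: "inj_on (inverse_horner B) {0..<(\<Prod>i<length B. B ! i)}"
proof (rule inj_onI)
  fix V W
  assume V: "V \<in> {0..<(\<Prod>i<length B. B ! i)}" and W: "W \<in> {0..<(\<Prod>i<length B. B ! i)}"
    and eq: "inverse_horner B V = inverse_horner B W"
  have digit: "horner_quotient B V j mod B ! (length B - Suc j)
      = horner_quotient B W j mod B ! (length B - Suc j)" if "j < length B" for j
  proof -
    define i where "i = length B - Suc j"
    have i: "i < length B" "length B - Suc i = j"
      using that by (auto simp: i_def)
    then have "inverse_horner B U ! i = horner_quotient B U j mod B ! i" for U
      by (simp add: inverse_horner_def)
    then have "horner_quotient B V j mod B ! i = horner_quotient B W j mod B ! i"
      using eq by metis
    then show ?thesis
      unfolding i_def .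
  qed
  have "0 \<le> length B" by simp
  then have "horner_quotient B V 0 = horner_quotient B W 0"
  \<comment> \<open>Downward induction from \<open>j = length B\<close>, where both quotients are 0:
    quotient and remainder together recover the previous value.\<close>
  proof (induction rule: inc_induct)
    case base
    show ?case
      using V W by (simp add: horner_quotient_eq_div lessThan_atLeast0)
  next
    case (step j)
    then show ?case
      using digit[of j] by (metis div_mod_decomp horner_quotient.simps(2))
  qed
  then show "V = W" by simp
qed

lemma pmf_message_cipher:
  "pmf (message_cipher_pmf enc M K) (m, c) = pmf M m * measure_pmf.prob K {key. enc key m = c}"
proof -
  have "(\<lambda>(m, key). (m, enc key m)) -` {(m, c)} = {m} \<times> {key. enc key m = c}"
    by auto
  moreover have "measure_pmf.prob (pair_pmf M K) ({m} \<times> {key. enc key m = c})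
      = measure_pmf.prob M {m} * measure_pmf.prob K {key. enc key m = c}"
  proof -
    \<comment> \<open>Intersecting with the support makes the key set countable, as the product rule
      requires.\<close>
    have "measure_pmf.prob (pair_pmf M K) ({m} \<times> {key. enc key m = c})
       = measure_pmf.prob (pair_pmf M K) ({m} \<times> ({key. enc key m = c} \<inter> set_pmf K))"
      by (intro measure_prob_cong_0) (auto simp: pmf_eq_0_set_pmf)
    also have "\<dots> = measure_pmf.prob M {m} * measure_pmf.prob K ({key. enc key m = c} \<inter> set_pmf K)"
      by (intro measure_pmf_prob_product) auto
    finally show ?thesis
      by (simp add: measure_Int_set_pmf)
  qed
  ultimately show ?thesis
    by (simp add: message_cipher_pmf_def pmf_map measure_pmf_single)
qed

lemma map_fst_message_cipher: "map_pmf fst (message_cipher_pmf enc M K) = M"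
proof -
  have "map_pmf fst (message_cipher_pmf enc M K) = map_pmf fst (pair_pmf M K)"
    by (simp add: message_cipher_pmf_def pmf.map_comp comp_def case_prod_unfold)
  then show ?thesis by (simp add: map_fst_pair_pmf)
qed

text \<open>Under the uniform distribution every message has positive probability, so secrecy can be
  divided by \<open>pmf M a\<close>: each side equals the probability of the ciphertext
  \<open>c\<close>.\<close>

lemma perfect_secrecy_cipher_prob_eq:
  assumes sec: "perfect_secrecy Msgs enc K" and fin: "finite Msgs"
    and "m \<in> Msgs" "m' \<in> Msgs"
  shows "measure_pmf.prob K {key. enc key m = c} = measure_pmf.prob K {key. enc key m' = c}"
proof -
  define M where "M = pmf_of_set Msgs"
  define J where "J = message_cipher_pmf enc M K"
  have setM: "set_pmf M = Msgs"
    using assms unfolding M_def by (intro set_pmf_of_set) auto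
  have fst: "measure_pmf.prob J {x. fst x = a} = pmf M a" for a
  proof -
    have "pmf M a = pmf (map_pmf fst J) a"
      by (simp add: J_def map_fst_message_cipher)
    then show ?thesis by (simp add: pmf_map vimage_def)
  qed
  have joint: "measure_pmf.prob J {x. fst x = a \<and> snd x = c}
      = pmf M a * measure_pmf.prob K {key. enc key a = c}" for a
  proof -
    have "{x. fst x = a \<and> snd x = c} = {(a, c)}" by auto
    then show ?thesis by (simp add: measure_pmf_single J_def pmf_message_cipher)
  qed
  have "measure_pmf.prob K {key. enc key a = c} = measure_pmf.prob J {x. snd x = c}"
    if a: "a \<in> Msgs" for a
  proof -
    have pos: "pmf M a > 0"
      using a setM by (simp add: pmf_positive)
    have le: "measure_pmf.prob J {x. fst x = a \<and> snd x = c} \<le> measure_pmf.prob J {x. snd x = c}"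
      by (intro measure_pmf.finite_measure_mono) auto
    show ?thesis
    proof (cases "measure_pmf.prob J {x. snd x = c} > 0")
      case True
      then have "\<P>(x in J. fst x = a \<bar> snd x = c) = \<P>(x in J. fst x = a)"
        using sec a setM unfolding perfect_secrecy_def J_def by simp
      with True pos show ?thesis
        by (simp add: cond_prob_def fst joint field_simps)
    next
      \<comment> \<open>Secrecy says nothing about a ciphertext of probability 0, but then the joint
        probability vanishes too, and \<open>pmf M a > 0\<close> forces the other factor to be
        0.\<close>
      case False
      then have "measure_pmf.prob J {x. snd x = c} = 0"
        by (simp add: zero_less_measure_iff)
      with le pos show ?thesis
        by (simp add: joint mult_le_0_iff measure_le_0_iff)
    qed
  qed
  then show ?thesis using assms by simp
qed

text \<open>
  Adding the message \<open>b\<^sub>i - 1 - x\<^sub>i\<close> to the key \<open>x\<^sub>i\<close> gives the digit \<open>b\<^sub>i - 1\<close> without wrapping around.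
\<close>

lemma mr_otp_key_determined:
  assumes "x \<in> digit_tuples B" "key \<in> digit_tuples B"
  shows "mr_otp_encrypt B key (map (\<lambda>i. B ! i - 1 - x ! i) [0..<length B])
           = map (\<lambda>i. B ! i - 1) [0..<length B] \<longleftrightarrow> key = x"
proof -
  have "(b - 1 - u + w) mod b = b - 1 \<longleftrightarrow> w = u" if "u < b" "w < b" for b u w :: nat
  proof (cases "w \<le> u")
    case True
    with that show ?thesis by auto
  next
    \<comment> \<open>The sum lies in \<open>{b..<2 * b}\<close> and reduces to
      \<open>w - u - 1\<close>, which is less than \<open>b - 1\<close>.\<close>
    case False
    with that have "(b - 1 - u + w) mod b = (b - 1 - u + w) - b"
      by (simp add: mod_if)
    with False that show ?thesis by auto
  qed
  then have "(B ! i - 1 - x ! i + key ! i) mod B ! i = B ! i - 1 \<longleftrightarrow> key ! i = x ! i"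
    if "i < length B" for i
    using assms that by (simp only: digit_tuples_def mem_Collect_eq atLeastLessThan_iff)
  moreover have "length key = length B" "length x = length B"
    using assms by (simp_all add: digit_tuples_def)
  ultimately show ?thesis
    by (simp add: mr_otp_encrypt_def list_eq_iff_nth_eq[of key] Ball_def del: One_nat_def)
qed

lemma perfect_secrecy_mr_otp_key_pmf_eq:
  assumes sec: "perfect_secrecy (digit_tuples B) (mr_otp_encrypt B) K"
    and supp: "set_pmf K \<subseteq> digit_tuples B"
    and "x \<in> digit_tuples B" "y \<in> digit_tuples B"
  shows "pmf K x = pmf K y"
proof -
  define c where "c = map (\<lambda>i. B ! i - 1) [0..<length B]"
  define msg where "msg z = map (\<lambda>i. B ! i - 1 - z ! i) [0..<length B]" for z
  have msg: "msg z \<in> digit_tuples B" if "z \<in> digit_tuples B" for z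
    using that by (auto simp: msg_def digit_tuples_def)
  have "measure_pmf.prob K {key. mr_otp_encrypt B key (msg z) = c} = pmf K z"
    if z: "z \<in> digit_tuples B" for z
  proof -
    \<comment> \<open>Uniqueness of the key holds only among digit tuples; other lists have
      probability 0 under \<open>K\<close>.\<close>
    have "{key. mr_otp_encrypt B key (msg z) = c} \<inter> set_pmf K = {z} \<inter> set_pmf K"
      using mr_otp_key_determined[OF z] supp unfolding c_def msg_def by blast
    then show ?thesis
      by (metis measure_Int_set_pmf measure_pmf_single)
  qed
  then show ?thesis
    using perfect_secrecy_cipher_prob_eq[OF sec finite_digit_tuples msg msg] assms by metis
qed

lemma pmf_uniform_mod:
  fixes P r v :: nat
  assumes "r < P" "v < P"
  shows "pmf (map_pmf (\<lambda>x. x mod P) (pmf_of_set {0..<P + r})) v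
       = (if v < r then 2 else 1) / (P + r)"
proof -
  \<comment> \<open>Since \<open>r < P\<close>, the range is shorter than two periods, and
    \<open>v + P\<close> falls inside it exactly when \<open>v < r\<close>.\<close>
  have "{0..<P + r} \<inter> (\<lambda>x. x mod P) -` {v} = (if v < r then {v, v + P} else {v})"
    using assms by (auto simp: mod_if split: if_splits)
  then have "card ({0..<P + r} \<inter> (\<lambda>x. x mod P) -` {v}) = (if v < r then 2 else 1)"
    using assms by simp
  then show ?thesis
    using assms by (simp add: pmf_map measure_pmf_of_set)
qed

lemma two_power_ceiling_log_bounds:
  fixes P :: nat
  assumes "P \<ge> 1"
  shows "P \<le> 2 ^ nat \<lceil>log 2 P\<rceil>" "2 ^ nat \<lceil>log 2 P\<rceil> < 2 * P"
proof -
  define k where "k = nat \<lceil>log 2 P\<rceil>"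
  have nonneg: "log 2 P \<ge> 0" using assms by simp
  have powr: "2 powr log 2 P = real P" "2 powr real k = real (2 ^ k)"
    using assms by (simp_all add: powr_realpow)
  have "2 powr log 2 P \<le> 2 powr real k"
    unfolding k_def by (intro powr_mono) linarith+
  then have "P \<le> 2 ^ k"
    unfolding powr of_nat_le_iff .
  \<comment> \<open>The strict bound comes from the ceiling of a real being less than that real plus
    1.\<close>
  moreover have "2 powr real k < 2 powr (1 + log 2 P)"
    using nonneg unfolding k_def by (intro powr_less_mono) linarith+
  then have "real (2 ^ k) < real (2 * P)"
    unfolding powr_add powr by simp
  then have "2 ^ k < 2 * P"
    unfolding of_nat_less_iff .
  ultimately show "P \<le> 2 ^ nat \<lceil>log 2 P\<rceil>" "2 ^ nat \<lceil>log 2 P\<rceil> < 2 * P"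
    unfolding k_def .
qed

theorem proposition3p1:
  fixes B :: "nat list" and L P k r :: nat
    and V V' :: "nat pmf" and K :: "nat list pmf"
  assumes "L \<ge> 1"
    and "length B = L"
    and "\<forall>i<L. B ! i \<ge> 2"
    and "P = (\<Prod>i<L. B ! i)"
    and "k = nat \<lceil>log 2 (real P)\<rceil>"
    and "r = 2 ^ k mod P"
    and "r > 0"
    and "V = pmf_of_set {0..<2 ^ k}"
    and "V' = map_pmf (\<lambda>v. v mod P) V"
    and "K = map_pmf (inverse_horner B) V'"
  shows "((\<forall>v\<in>{0..<r}. pmf V' v = 2 / 2 ^ k) \<and> (\<forall>v\<in>{r..<P}. pmf V' v = 1 / 2 ^ k))
    \<and> K \<noteq> pmf_of_set (digit_tuples B)
    \<and> \<not> perfect_secrecy (digit_tuples B) (mr_otp_encrypt B) K"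
proof -
  have pos: "\<forall>i<length B. B ! i > 0"
    using assms(2,3) by fastforce
  then have P: "P \<ge> 1"
    unfolding assms(4) by (simp add: assms(2) Suc_le_eq prod_pos)
  have rP: "r < P" using P assms(6) by simp
  \<comment> \<open>As \<open>2 ^ k\<close> lies in \<open>{P..<2 * P}\<close>, reduction modulo
    \<open>P\<close> subtracts \<open>P\<close> exactly once.\<close>
  have pow: "2 ^ k = P + r"
    using two_power_ceiling_log_bounds[OF P] unfolding assms(6) assms(5)[symmetric]
    by (simp add: le_mod_geq)
  have V': "pmf V' v = (if v < r then 2 else 1) / 2 ^ k" if "v < P" for v
    using pmf_uniform_mod[OF rP that] unfolding assms(8,9) by (simp flip: pow)
  have supp: "set_pmf V' \<subseteq> {0..<P}"
    using P unfolding assms(9) by auto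
  have inj: "inj_on (inverse_horner B) {0..<P}"
    using inj_on_inverse_horner[of B] assms(2,4) by simp
  have K: "pmf K (inverse_horner B v) = pmf V' v" if "v < P" for v
  proof -
    have "inverse_horner B -` {inverse_horner B v} \<inter> set_pmf V' = {v} \<inter> set_pmf V'"
      using inj supp that by (auto dest: inj_onD)
    then show ?thesis
      unfolding assms(10) pmf_map by (metis measure_Int_set_pmf measure_pmf_single)
  qed
  \<comment> \<open>\<open>r > 0\<close> puts 0 among the values hit twice, while
    \<open>r < P\<close> leaves \<open>P - 1\<close> among those hit once.\<close>
  let ?x = "inverse_horner B 0" and ?y = "inverse_horner B (P - 1)"
  have xy: "?x \<in> digit_tuples B" "?y \<in> digit_tuples B"
    using inverse_horner_in_digit_tuples[OF pos] by auto
  have neq: "pmf K ?x \<noteq> pmf K ?y"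
    using K[of 0] K[of "P - 1"] V'[of 0] V'[of "P - 1"] P rP assms(7) by simp
  have "K \<noteq> pmf_of_set (digit_tuples B)"
    using neq xy finite_digit_tuples[of B] by (metis empty_iff indicator_simps(1) pmf_of_set)
  moreover have "\<not> perfect_secrecy (digit_tuples B) (mr_otp_encrypt B) K"
    using neq xy perfect_secrecy_mr_otp_key_pmf_eq[of B K] inverse_horner_in_digit_tuples[OF pos]
    unfolding assms(10) by auto
  ultimately show ?thesis
    using V' rP by auto
qed

end
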